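(* Let $u\in\mathcal{F}^n$ be a fuzzy vector. Then the fuzzy vector $\mathsf{c}(u)$ is skew, and there exists a symmetric fuzzy vector $\mathsf{s}(u)\in\mathcal{F}^n_{\mathsf{s}}$ such that $u=\mathsf{c}(u)\oplus\mathsf{s}(u)$. Hence, $\mathsf{c}(u)$ is a Mareš core of $u$.
   Context: Let $n\geq 1$; $O(n)$ is the group of $n\times n$ orthogonal matrices. A fuzzy vector (of dimension $n$) is a function $u:\mathbb{R}^n\to[0,1]$ such that: (V1) there is $t_0\in\mathbb{R}^n$ with $u(t_0)=1$; (V2) the closure of $\{t\in\mathbb{R}^n\mid u(t)>0\}$ is compact; (V3) $\min(u(s),u(t))\leq u(\lambda s+(1-\lambda)t)$ for all $s,t\in\mathbb{R}^n$ and $\lambda\in[0,1]$; (V4) $\{t\in\mathbb{R}^n\mid u(t)\geq\alpha\}$ is closed for all $\alpha\in[0,1]$. $\mathcal{F}^n$ is the set of all fuzzy vectors of dimension $n$. The level sets are $u_\alpha=\{t\mid u(t)\geq\alpha\}$ for $\alpha\in(0,1]$ and $u_0=\overline{\{t\mid u(t)>0\}}$. The sum is $(u\oplus v)(t):=\sup_{r+s=t}\min(u(r),v(s))$. A fuzzy vector $u$ is symmetric if $u(t)=u(Qt)$ for all $t\in\mathbb{R}^n$, $Q\in O(n)$; $\mathcal{F}^n_{\mathsf{s}}$ is the set of symmetric fuzzy vectors. $\tilde{o}$ is the fuzzy vector with value $1$ at the origin and $0$ elsewhere. A fuzzy vector $u$ is skew if whenever $u=v\oplus w$ with $v\in\mathcal{F}^n$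 and $w\in\mathcal{F}^n_{\mathsf{s}}$, then $w=\tilde{o}$. A fuzzy vector $v$ is a Mareš core of $u$ if $v$ is skew and $u=v\oplus w$ for some $w\in\mathcal{F}^n_{\mathsf{s}}$. For $u\in\mathcal{F}^n$ put $\Upsilon_u:=\{v\in\mathcal{F}^n\mid u=v\oplus w\text{ for some }w\in\mathcal{F}^n_{\mathsf{s}}\}$. The fuzzy vector $\mathsf{c}(u)\in\mathcal{F}^n$ is the one whose level sets are $\mathsf{c}(u)_\alpha=\bigcap_{v\in\Upsilon_u}v_\alpha$ for $\alpha\in(0,1]$ and $\mathsf{c}(u)_0=\overline{\bigcup_{\beta\in(0,1]}\mathsf{c}(u)_\beta}$ (such a fuzzy vector exists and is unique). *)

theory Defs
  imports "HOL-Analysis.Analysis"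
begin

definition fuzzy_vectors :: "(real ^ 'n \<Rightarrow> real) set" where
  "fuzzy_vectors = {u.
     (\<forall>t. u t \<in> {0..1}) \<and>
     (\<exists>t0. u t0 = 1) \<and>
     compact (closure {t. u t > 0}) \<and>
     (\<forall>s t. \<forall>\<mu>\<in>{0..1}. min (u s) (u t) \<le> u (\<mu> *\<^sub>R s + (1 - \<mu>) *\<^sub>R t)) \<and>
     (\<forall>\<alpha>\<in>{0..1}. closed {t. u t \<ge> \<alpha>})}"

text \<open>Only meaningful for levels in the unit interval; level 0 is the closure of the support.\<close>

definition level_set :: "(real ^ 'n \<Rightarrow> real) \<Rightarrow> real \<Rightarrow> (real ^ 'n) set" where
  "level_set u \<alpha> = (if \<alpha> = 0 then closure {t. u t > 0} else {t. u t \<ge> \<alpha>})"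

text \<open>On fuzzy vectors the supremum is over a nonempty set of reals bounded by 1,
  so it is a genuine supremum.\<close>

definition fuzzy_add ::
  "(real ^ 'n \<Rightarrow> real) \<Rightarrow> (real ^ 'n \<Rightarrow> real) \<Rightarrow> (real ^ 'n \<Rightarrow> real)" (infixl "\<oplus>" 65) where
  "u \<oplus> v = (\<lambda>t. Sup {min (u r) (v s) | r s. r + s = t})"

definition symmetric_fuzzy_vectors :: "(real ^ 'n \<Rightarrow> real) set" where
  "symmetric_fuzzy_vectors =
     {u \<in> fuzzy_vectors. \<forall>t. \<forall>Q :: real ^ 'n ^ 'n. orthogonal_matrix Q \<longrightarrow> u t = u (Q *v t)}"

definition fuzzy_zero :: "real ^ 'n \<Rightarrow> real" where
  "fuzzy_zero = (\<lambda>t. if t = 0 then 1 else 0)"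

definition skew :: "(real ^ 'n \<Rightarrow> real) \<Rightarrow> bool" where
  "skew u \<longleftrightarrow> u \<in> fuzzy_vectors \<and>
     (\<forall>v\<in>fuzzy_vectors. \<forall>w\<in>symmetric_fuzzy_vectors. u = v \<oplus> w \<longrightarrow> w = fuzzy_zero)"

definition is_mares_core :: "(real ^ 'n \<Rightarrow> real) \<Rightarrow> (real ^ 'n \<Rightarrow> real) \<Rightarrow> bool" where
  "is_mares_core v u \<longleftrightarrow>
     v \<in> fuzzy_vectors \<and> skew v \<and> (\<exists>w\<in>symmetric_fuzzy_vectors. u = v \<oplus> w)"

definition Upsilon :: "(real ^ 'n \<Rightarrow> real) \<Rightarrow> (real ^ 'n \<Rightarrow> real) set" where
  "Upsilon u = {v \<in> fuzzy_vectors. \<exists>w\<in>symmetric_fuzzy_vectors. u = v \<oplus> w}"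

text \<open>For every fuzzy vector \<open>u\<close> exactly one fuzzy vector has these level sets.\<close>

definition core_part :: "(real ^ 'n \<Rightarrow> real) \<Rightarrow> (real ^ 'n \<Rightarrow> real)" where
  "core_part u = (THE c. c \<in> fuzzy_vectors \<and>
     (\<forall>\<alpha>\<in>{0<..1}. level_set c \<alpha> = (\<Inter>v\<in>Upsilon u. level_set v \<alpha>)) \<and>
     level_set c 0 = closure (\<Union>\<beta>\<in>{0<..1}. level_set c \<beta>))"

end

theory Submission
  imports Defs
begin

text \<open>
  A fuzzy vector is determined by its level sets at the levels in \<open>{0<..1}\<close>, which form a decreasing,
  left-continuous family of nonempty compact convex sets; every such bounded family occurs
  (\<open>fuzzy_vector_with_level_sets\<close>). The sum of fuzzy vectors is the Minkowski sum of the level sets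
  (\<open>level_set_add\<close>), and a fuzzy vector is symmetric iff its level sets are balls around the origin
  (\<open>symmetric_iff_level_balls\<close>). Hence \<open>Upsilon u\<close> consists of the ways to split a ball off every level
  set of \<open>u\<close> compatibly.

  At a single level this is governed by cancellation of balls: if \<open>C + cball 0 r = U\<close> with \<open>C\<close> compact
  convex, then \<open>C\<close> consists of the points \<open>x\<close> with \<open>{x} + cball 0 r \<subseteq> U\<close>. So \<open>C\<close> depends only on \<open>r\<close>
  and shrinks as \<open>r\<close> grows, and all such summands form a chain. Compactness turns the intersection
  of any family of them into the summand that belongs to the supremum of the radii
  (\<open>Inter_ball_summands\<close>). Applied at every level, this yields \<open>u = c \<oplus> s\<close>, where \<open>c\<close> has the
  intersections as level sets and \<open>s\<close> has the balls with the supremal radii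
  (\<open>core_decomposition\<close>). That these balls again form a left-continuous family, although a supremum
  of left-continuous functions need not be left-continuous, follows from the left-continuity of \<open>u\<close>
  by comparing radii.

  Skewness of \<open>c\<close> is minimality: if \<open>c = v \<oplus> w\<close> with \<open>w\<close> symmetric, then \<open>u = v \<oplus> (w \<oplus> s)\<close>
  exhibits \<open>v\<close> as a member of \<open>Upsilon u\<close>, so the level sets of \<open>c\<close> lie in those of \<open>v\<close>. But they
  are the latter enlarged by balls, and a bounded set cannot contain its enlargement by a ball of
  positive radius (\<open>skew_if_below_Upsilon\<close>).
\<close>

section \<open>Cancelling balls in Minkowski sums\<close>

lemma set_plus_mono: "A \<subseteq> A' \<Longrightarrow> B \<subseteq> B' \<Longrightarrow> A + B \<subseteq> (A' + B' :: 'a::plus set)"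
  by (auto simp: set_plus_def)

lemma compact_set_plus:
  fixes A B :: "'a::real_normed_vector set"
  assumes "compact A" "compact B"
  shows "compact (A + B)"
proof -
  have "A + B = {x + y |x y. x \<in> A \<and> y \<in> B}"
    by (auto simp: set_plus_def)
  with compact_sums[OF assms] show ?thesis by simp
qed

lemma cball_plus_cball:
  fixes a b :: real
  assumes "0 \<le> a" "0 \<le> b"
  shows "cball (0::'a::real_normed_vector) a + cball 0 b = cball 0 (a + b)"
proof
  show "cball (0::'a) a + cball 0 b \<subseteq> cball 0 (a + b)"
  proof
    fix x :: 'a assume "x \<in> cball 0 a + cball 0 b"
    then obtain y z where "x = y + z" "norm y \<le> a" "norm z \<le> b"
      by (auto simp: set_plus_def)
    then show "x \<in> cball 0 (a + b)"
      using norm_triangle_ineq[of y z] by simp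
  qed
  show "cball (0::'a) (a + b) \<subseteq> cball 0 a + cball 0 b"
  proof
    fix x :: 'a assume x: "x \<in> cball 0 (a + b)"
    show "x \<in> cball 0 a + cball 0 b"
    proof (cases "a + b = 0")
      case True
      with assms have "a = 0" "b = 0" by linarith+
      with x show ?thesis by (auto simp: set_plus_def)
    next
      case False
      with assms have pos: "0 < a + b" by simp
      have part: "(c / (a + b)) *\<^sub>R x \<in> cball 0 c" if "0 \<le> c" for c
      proof -
        have "c * norm x \<le> c * (a + b)"
          using x that by (intro mult_left_mono) auto
        with pos that show ?thesis by (simp add: field_simps)
      qed
      have "x = (a / (a + b)) *\<^sub>R x + (b / (a + b)) *\<^sub>R x"
        using pos by (simp flip: scaleR_left_distrib add_divide_distrib)
      then show ?thesis
        using set_plus_intro[OF part[OF assms(1)] part[OF assms(2)]] by simp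
    qed
  qed
qed

text \<open>A hyperplane that strictly separates \<open>x\<close> from \<open>C\<close> still separates after both sides are thickened
  by \<open>r\<close>: the thickened \<open>C\<close> moves by \<open>r\<close> towards \<open>x\<close>, and the point of \<open>{x} + cball 0 r\<close>
  that is farthest from \<open>C\<close> moves away by the same amount.\<close>

lemma ball_cancel:
  fixes C :: "'a::euclidean_space set"
  assumes "convex C" "closed C" "0 \<le> r"
    and sub: "{x} + cball 0 r \<subseteq> C + cball 0 r"
  shows "x \<in> C"
proof (rule ccontr)
  assume "x \<notin> C"
  then obtain a b where ax: "inner a x < b" and aC: "\<And>c. c \<in> C \<Longrightarrow> b < inner a c"
    using separating_hyperplane_closed_point[OF assms(1,2)] by blast
  \<comment> \<open>the step of length \<open>r\<close> in the direction away from \<open>C\<close>\<close>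
  define z where "z = - (r / norm a) *\<^sub>R a"
  have nz: "norm z \<le> r" and az: "inner a z = - r * norm a"
    using assms(3) by (auto simp: z_def power2_norm_eq_inner[symmetric] power2_eq_square)
  have "x + z \<in> {x} + cball 0 r" using nz by (auto simp: set_plus_def)
  with sub have "x + z \<in> C + cball 0 r" by blast
  then obtain c w where c: "c \<in> C" and w: "norm w \<le> r" and eq: "x + z = c + w"
    by (auto simp: set_plus_def)
  have "- inner a w \<le> norm a * norm w" using Cauchy_Schwarz_ineq2[of a w] by linarith
  also have "\<dots> \<le> norm a * r" using w by (intro mult_left_mono) auto
  finally have "- inner a w \<le> r * norm a" by (simp add: mult.commute)
  moreover have "inner a x + inner a z = inner a c + inner a w"
    using eq by (metis inner_add_right)
  ultimately show False using ax aC[OF c] az by linarith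
qed

text \<open>The maximum over \<open>C + cball 0 a\<close> of the inner product with a unit vector \<open>e\<close> exceeds the maximum
  over \<open>C\<close> by exactly \<open>a\<close>; inclusion of the sets orders these maxima.\<close>

lemma radius_le_if_sum_subset:
  fixes C :: "'a::euclidean_space set"
  assumes "compact C" "C \<noteq> {}" "0 \<le> a"
    and sub: "C + cball 0 a \<subseteq> C + cball 0 b"
  shows "a \<le> b"
proof -
  obtain e :: 'a where e: "norm e = 1" using vector_choose_size[of 1] by auto
  obtain x where x: "x \<in> C" and max: "\<And>y. y \<in> C \<Longrightarrow> inner e y \<le> inner e x"
    using continuous_attains_sup[OF assms(1,2) continuous_on_inner[OF continuous_on_const continuous_on_id]]
    by blast
  have "x + a *\<^sub>R e \<in> C + cball 0 a" using x e assms(3) by (intro set_plus_intro) auto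
  with sub have "x + a *\<^sub>R e \<in> C + cball 0 b" by blast
  then obtain c w where c: "c \<in> C" and w: "norm w \<le> b" and eq: "x + a *\<^sub>R e = c + w"
    by (auto simp: set_plus_def)
  have "inner e x + a = inner e c + inner e w"
    using arg_cong[OF eq, of "inner e"] e
    by (simp add: inner_add_right power2_norm_eq_inner[symmetric])
  moreover have "inner e w \<le> b" using norm_cauchy_schwarz[of e w] e w by simp
  ultimately show ?thesis using max[OF c] by linarith
qed

text \<open>A translated ball of radius \<open>r\<close> inside \<open>U\<close> contains two antipodal points at distance \<open>2 * r\<close>.\<close>

lemma summand_radius_bound:
  fixes U :: "'a::euclidean_space set"
  assumes "bounded U"
  obtains M where "\<And>C r. \<lbrakk>C \<noteq> {}; 0 \<le> r; C + cball 0 r \<subseteq> U\<rbrakk> \<Longrightarrow> r \<le> M"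
proof -
  obtain M where M: "\<And>x. x \<in> U \<Longrightarrow> norm x \<le> M" using assms by (auto simp: bounded_iff)
  have "r \<le> M" if C: "C \<noteq> {}" and r: "0 \<le> r" and sum: "C + cball 0 r \<subseteq> U" for C r
  proof -
    obtain c where c: "c \<in> C" using C by auto
    obtain e :: 'a where e: "norm e = r" using vector_choose_size[OF r] by auto
    have "c + e \<in> U" "c - e \<in> U"
      using c e set_plus_intro[OF c, of e "cball 0 r"] set_plus_intro[OF c, of "-e" "cball 0 r"] sum
      by auto
    then have "norm (c + e) \<le> M" "norm (c - e) \<le> M" using M by auto
    moreover have "norm ((c + e) - (c - e)) \<le> norm (c + e) + norm (c - e)"
      by (rule norm_triangle_ineq4)
    moreover have "(c + e) - (c - e) = 2 *\<^sub>R e" by (simp add: scaleR_2)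
    ultimately show ?thesis using e by simp
  qed
  then show ?thesis by (rule that)
qed

text \<open>By cancellation a larger radius leaves a smaller summand, so the sets \<open>C i\<close> form a chain. The
  supremal radius need not be attained. For \<open>x \<in> U\<close> the sets \<open>C i \<inter> cball x R\<close>, with
  \<open>R\<close> the supremum, are nonempty because \<open>r i \<le> R\<close>, and they form a chain of compact sets, so they
  have a common point \<open>y\<close>, and \<open>x = y + (x - y)\<close>. Conversely, the open ball of radius \<open>R\<close> around a
  common point of the \<open>C i\<close> is covered by balls of radius \<open>r i\<close> inside \<open>U\<close>, and \<open>U\<close> is closed.\<close>

lemma Inter_ball_summands:
  fixes C :: "'i \<Rightarrow> 'a::euclidean_space set" and r :: "'i \<Rightarrow> real"
  assumes "I \<noteq> {}"
    and convex: "\<And>i. i \<in> I \<Longrightarrow> convex (C i)"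
    and compact: "\<And>i. i \<in> I \<Longrightarrow> compact (C i)"
    and ne: "\<And>i. i \<in> I \<Longrightarrow> C i \<noteq> {}"
    and r0: "\<And>i. i \<in> I \<Longrightarrow> 0 \<le> r i"
    and sum: "\<And>i. i \<in> I \<Longrightarrow> C i + cball 0 (r i) = U"
  shows "bdd_above (r ` I)"
    and "(\<Inter>i\<in>I. C i) + cball 0 (SUP i\<in>I. r i) = U"
proof -
  obtain i0 where i0: "i0 \<in> I" using assms(1) by blast
  have cU: "compact U"
    using compact_set_plus[OF compact[OF i0] compact_cball, of 0 "r i0"] sum[OF i0] by simp
  obtain M where M: "\<And>C r. \<lbrakk>C \<noteq> {}; 0 \<le> r; C + cball 0 r \<subseteq> U\<rbrakk> \<Longrightarrow> r \<le> M"
    using summand_radius_bound[OF compact_imp_bounded[OF cU]] by metis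
  show bdd: "bdd_above (r ` I)"
    using M[OF ne r0 equalityD1[OF sum]] by (intro bdd_aboveI2[where M=M]) auto
  define R where "R = (SUP i\<in>I. r i)"
  have rR: "r i \<le> R" if "i \<in> I" for i
    unfolding R_def using bdd that by (rule cSUP_upper2) simp
  have R0: "0 \<le> R" using rR[OF i0] r0[OF i0] by simp
  have sub: "C j \<subseteq> C i" if ij: "i \<in> I" "j \<in> I" and le: "r i \<le> r j" for i j
  proof
    fix x assume x: "x \<in> C j"
    have "{x} + cball 0 (r i) \<subseteq> C j + cball 0 (r j)"
      using x le by (intro set_plus_mono) auto
    then have "{x} + cball 0 (r i) \<subseteq> C i + cball 0 (r i)" using sum ij by simp
    then show "x \<in> C i"
      using ball_cancel[OF convex[OF ij(1)] compact_imp_closed[OF compact[OF ij(1)]] r0[OF ij(1)]] by blast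
  qed
  show "(\<Inter>i\<in>I. C i) + cball 0 (SUP i\<in>I. r i) = U"
    unfolding R_def[symmetric]
  proof
    show "U \<subseteq> (\<Inter>i\<in>I. C i) + cball 0 R"
    proof
      fix x assume xU: "x \<in> U"
      let ?F = "(\<lambda>i. C i \<inter> cball x R) ` I"
      have "\<Inter>?F \<noteq> {}"
      proof (rule compact_chain)
        show "compact S" if "S \<in> ?F" for S
          using that compact by (auto intro: compact_Int)
        show "{} \<notin> ?F"
        proof
          assume "{} \<in> ?F"
          then obtain i where i: "i \<in> I" and e: "C i \<inter> cball x R = {}" by auto
          obtain c w where "c \<in> C i" "norm w \<le> r i" "x = c + w"
            using xU sum[OF i] by (auto simp: set_plus_def)
          with e rR[OF i] show False by (auto simp: disjoint_iff dist_norm)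
        qed
        show "S \<subseteq> T \<or> T \<subseteq> S" if "S \<in> ?F \<and> T \<in> ?F" for S T
        proof -
          from that obtain i j where ij: "i \<in> I" "j \<in> I"
            and ST: "S = C i \<inter> cball x R" "T = C j \<inter> cball x R"
            by auto
          from sub[OF ij] sub[OF ij(2,1)] show ?thesis
            unfolding ST by (cases "r i \<le> r j") auto
        qed
      qed
      then obtain y where y: "\<And>i. i \<in> I \<Longrightarrow> y \<in> C i \<inter> cball x R"
        by blast
      then have "y \<in> (\<Inter>i\<in>I. C i)" "x - y \<in> cball 0 R" using y[OF i0] by (auto simp: dist_norm norm_minus_commute)
      then have "y + (x - y) \<in> (\<Inter>i\<in>I. C i) + cball 0 R" by (rule set_plus_intro)
      then show "x \<in> (\<Inter>i\<in>I. C i) + cball 0 R" by simp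
    qed
    show "(\<Inter>i\<in>I. C i) + cball 0 R \<subseteq> U"
    proof
      fix x assume "x \<in> (\<Inter>i\<in>I. C i) + cball 0 R"
      then obtain c w where "c \<in> (\<Inter>i\<in>I. C i)" and "w \<in> cball 0 R" and x: "x = c + w"
        by (elim set_plus_elim)
      then have c: "\<And>i. i \<in> I \<Longrightarrow> c \<in> C i" and w: "norm w \<le> R" by auto
      show "x \<in> U"
        \<comment> \<open>for \<open>R = 0\<close> the open ball is empty and its closure misses the centre\<close>
      proof (cases "R = 0")
        case True
        with w have "w \<in> cball 0 (r i0)" using r0[OF i0] by simp
        then show ?thesis using c[OF i0] sum[OF i0] x by blast
      next
        case False
        with R0 have Rp: "0 < R" by simp
        have open_ball: "c + z \<in> U" if z: "norm z < R" for z
        proof -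
          obtain i where "i \<in> I" "norm z < r i"
            using z less_cSUP_iff[OF assms(1) bdd, of "norm z"] by (auto simp: R_def)
          then have "c + z \<in> C i + cball 0 (r i)" using c by (intro set_plus_intro) auto
          then show ?thesis using sum \<open>i \<in> I\<close> by simp
        qed
        have "(+) c ` closure (ball 0 R) \<subseteq> closure U"
        proof (rule image_closure_subset)
          show "(+) c ` ball 0 R \<subseteq> closure U"
          proof (rule image_subsetI)
            fix z :: 'a assume "z \<in> ball 0 R"
            then have "c + z \<in> U" by (intro open_ball) simp
            then show "c + z \<in> closure U" using closure_subset by blast
          qed
        qed (auto intro!: continuous_intros)
        then have "(+) c ` cball 0 R \<subseteq> U"
          using Rp closure_closed[OF compact_imp_closed[OF cU]] by simp
        moreover have "x \<in> (+) c ` cball 0 R" using w unfolding x by (intro imageI) simp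
        ultimately show ?thesis by blast
      qed
    qed
  qed
qed

section \<open>Fuzzy vectors through their level sets\<close>

lemma level_set_pos: "0 < \<alpha> \<Longrightarrow> level_set u \<alpha> = {t. \<alpha> \<le> u t}"
  by (simp add: level_set_def)

text \<open>The defining conditions are all conditions on the levels in \<open>{0<..1}\<close>: level 0 imposes nothing
  on a nonnegative function, and the support is the union of the positive levels.\<close>

lemma fuzzy_vectorI:
  fixes u :: "real ^ 'n \<Rightarrow> real"
  assumes range: "\<And>t. u t \<in> {0..1}"
    and levels: "\<And>\<alpha>. \<alpha> \<in> {0<..1} \<Longrightarrow>
      level_set u \<alpha> \<noteq> {} \<and> convex (level_set u \<alpha>) \<and> closed (level_set u \<alpha>) \<and> level_set u \<alpha> \<subseteq> B"
    and "bounded B"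
  shows "u \<in> fuzzy_vectors"
proof -
  have lev: "level_set u \<alpha> = {t. \<alpha> \<le> u t}" if "0 < \<alpha>" for \<alpha>
    using that by (rule level_set_pos)
  have "\<exists>t0. u t0 = 1"
  proof -
    have "level_set u 1 \<noteq> {}" using levels[of 1] by simp
    then obtain t where "1 \<le> u t" by (auto simp: lev)
    moreover have "u t \<le> 1" using range[of t] by simp
    ultimately show ?thesis by (auto intro!: exI[of _ t])
  qed
  moreover have "compact (closure {t. u t > 0})"
  proof -
    have "{t. u t > 0} \<subseteq> B"
    proof
      fix t assume t: "t \<in> {t. u t > 0}"
      then have "u t \<in> {0<..1}" using range[of t] by simp
      from levels[OF this] show "t \<in> B" using t by (auto simp: lev)
    qed
    then show ?thesis using \<open>bounded B\<close> bounded_subset by (auto simp: compact_closure)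
  qed
  moreover have "min (u s) (u t) \<le> u (\<mu> *\<^sub>R s + (1 - \<mu>) *\<^sub>R t)" if "\<mu> \<in> {0..1}" for s t \<mu>
  proof (cases "min (u s) (u t) \<le> 0")
    case True
    then show ?thesis using range[of "\<mu> *\<^sub>R s + (1 - \<mu>) *\<^sub>R t"] by simp
  next
    case False
    let ?m = "min (u s) (u t)"
    have m: "?m \<in> {0<..1}" using False range[of s] by auto
    have "convex {x. ?m \<le> u x}" using levels[OF m] lev[of ?m] m by simp
    then have "\<mu> *\<^sub>R s + (1 - \<mu>) *\<^sub>R t \<in> {x. ?m \<le> u x}"
      using that by (intro convexD) auto
    then show ?thesis by simp
  qed
  moreover have "closed {t. u t \<ge> \<alpha>}" if "\<alpha> \<in> {0..1}" for \<alpha>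
  proof (cases "\<alpha> = 0")
    case True
    then have "{t. u t \<ge> \<alpha>} = UNIV" using range by auto
    then show ?thesis by simp
  next
    case False
    with that have "\<alpha> \<in> {0<..1}" by simp
    from levels[OF this] show ?thesis using lev[of \<alpha>] that False by simp
  qed
  ultimately show ?thesis using range by (simp add: fuzzy_vectors_def)
qed

lemma fuzzy_vector_range: "u \<in> fuzzy_vectors \<Longrightarrow> 0 \<le> u t \<and> u t \<le> 1"
  unfolding fuzzy_vectors_def mem_Collect_eq atLeastAtMost_iff by blast

lemma level_set_nonempty: "u \<in> fuzzy_vectors \<Longrightarrow> \<alpha> \<in> {0<..1} \<Longrightarrow> level_set u \<alpha> \<noteq> {}"
proof -
  assume u: "u \<in> fuzzy_vectors" and \<alpha>: "\<alpha> \<in> {0<..1}"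
  obtain t where "u t = 1" using u by (auto simp: fuzzy_vectors_def)
  then have "t \<in> level_set u \<alpha>" using \<alpha> by (simp add: level_set_pos)
  then show ?thesis by auto
qed

lemma bounded_support: "u \<in> fuzzy_vectors \<Longrightarrow> bounded {t. u t > 0}"
  unfolding fuzzy_vectors_def mem_Collect_eq compact_closure by blast

lemma level_set_subset_support: "0 < \<alpha> \<Longrightarrow> level_set u \<alpha> \<subseteq> {t. u t > 0}"
  by (auto simp: level_set_pos)

lemma level_set_compact:
  assumes "u \<in> fuzzy_vectors" "\<alpha> \<in> {0<..1}"
  shows "compact (level_set u \<alpha>)"
proof -
  have "bounded (level_set u \<alpha>)"
    using bounded_subset[OF bounded_support level_set_subset_support] assms by auto
  moreover have "closed (level_set u \<alpha>)"
    using assms by (auto simp: level_set_pos fuzzy_vectors_def)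
  ultimately show ?thesis by (simp add: compact_eq_bounded_closed)
qed

lemma level_set_convex:
  assumes "u \<in> fuzzy_vectors" "\<alpha> \<in> {0<..1}"
  shows "convex (level_set u \<alpha>)"
proof (rule convexI)
  fix x y :: "real ^ 'a" and a b :: real
  assume xy: "x \<in> level_set u \<alpha>" "y \<in> level_set u \<alpha>" and ab: "0 \<le> a" "0 \<le> b" "a + b = 1"
  have "min (u x) (u y) \<le> u (a *\<^sub>R x + (1 - a) *\<^sub>R y)"
    using assms(1) ab by (auto simp: fuzzy_vectors_def)
  moreover have "1 - a = b" using ab by simp
  ultimately show "a *\<^sub>R x + b *\<^sub>R y \<in> level_set u \<alpha>"
    using xy assms(2) by (auto simp: level_set_pos)
qed

lemma level_set_antimono: "0 < \<beta> \<Longrightarrow> \<beta> \<le> \<alpha> \<Longrightarrow> level_set u \<alpha> \<subseteq> level_set u \<beta>"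
  by (auto simp: level_set_pos)

text \<open>This closure property, together with monotonicity, is what distinguishes the level sets of a
  function from an arbitrary decreasing family of sets.\<close>

lemma level_set_left_continuous:
  assumes "0 < \<alpha>" "\<And>\<beta>. \<lbrakk>0 < \<beta>; \<beta> < \<alpha>\<rbrakk> \<Longrightarrow> t \<in> level_set u \<beta>"
  shows "t \<in> level_set u \<alpha>"
proof -
  have "\<alpha> \<le> u t"
    by (rule dense_le_bounded[OF assms(1)]) (use assms(2) in \<open>auto simp: level_set_pos\<close>)
  then show ?thesis using assms(1) by (simp add: level_set_pos)
qed

lemma unit_interval_eqI:
  fixes a b :: real
  assumes "a \<in> {0..1}" "b \<in> {0..1}" "\<And>\<alpha>. \<alpha> \<in> {0<..1} \<Longrightarrow> \<alpha> \<le> a \<longleftrightarrow> \<alpha> \<le> b"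
  shows "a = b"
proof (rule antisym)
  show "a \<le> b" using assms(3)[of a] assms(1,2) by (cases "a = 0") auto
  show "b \<le> a" using assms(3)[of b] assms(1,2) by (cases "b = 0") auto
qed

lemma fuzzy_vector_eqI:
  assumes "u \<in> fuzzy_vectors" "v \<in> fuzzy_vectors"
    and "\<And>\<alpha>. \<alpha> \<in> {0<..1} \<Longrightarrow> level_set u \<alpha> = level_set v \<alpha>"
  shows "u = v"
proof
  fix t
  show "u t = v t"
  proof (rule unit_interval_eqI)
    fix \<alpha> :: real assume "\<alpha> \<in> {0<..1}"
    with assms(3)[OF this] show "\<alpha> \<le> u t \<longleftrightarrow> \<alpha> \<le> v t"
      by (auto simp: level_set_pos set_eq_iff)
  qed (use fuzzy_vector_range assms in auto)
qed

lemma level_set_zero: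
  assumes "u \<in> fuzzy_vectors"
  shows "level_set u 0 = closure (\<Union>\<beta>\<in>{0<..1}. level_set u \<beta>)"
proof -
  have "{t. u t > 0} = (\<Union>\<beta>\<in>{0<..1}. level_set u \<beta>)"
    using fuzzy_vector_range[OF assms] by (force simp: level_set_pos)
  then show ?thesis by (simp add: level_set_def)
qed

text \<open>The value at \<open>t\<close> is the supremum of the levels whose set contains \<open>t\<close>; left-continuity of the
  family says that this supremum is attained.\<close>

lemma fuzzy_vector_with_level_sets:
  fixes K :: "real \<Rightarrow> (real ^ 'n) set"
  assumes levels: "\<And>\<alpha>. \<alpha> \<in> {0<..1} \<Longrightarrow> K \<alpha> \<noteq> {} \<and> convex (K \<alpha>) \<and> closed (K \<alpha>) \<and> K \<alpha> \<subseteq> B"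
    and "bounded B"
    and anti: "\<And>\<alpha> \<beta>. \<lbrakk>\<alpha> \<in> {0<..1}; 0 < \<beta>; \<beta> \<le> \<alpha>\<rbrakk> \<Longrightarrow> K \<alpha> \<subseteq> K \<beta>"
    and left: "\<And>\<alpha> t. \<lbrakk>\<alpha> \<in> {0<..1}; \<And>\<beta>. \<lbrakk>0 < \<beta>; \<beta> < \<alpha>\<rbrakk> \<Longrightarrow> t \<in> K \<beta>\<rbrakk> \<Longrightarrow> t \<in> K \<alpha>"
  obtains u where "u \<in> fuzzy_vectors" "\<And>\<alpha>. \<alpha> \<in> {0<..1} \<Longrightarrow> level_set u \<alpha> = K \<alpha>"
proof -
  \<comment> \<open>inserting \<open>0\<close> gives points outside all \<open>K \<alpha>\<close> the value \<open>0\<close> instead of the supremum of the empty set\<close>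
  define A where "A = (\<lambda>t. insert 0 {\<alpha> \<in> {0<..1}. t \<in> K \<alpha>})"
  define u where "u = (\<lambda>t. Sup (A t))"
  have bdd: "bdd_above (A t)" for t by (rule bdd_aboveI[of _ 1]) (auto simp: A_def)
  have range: "u t \<in> {0..1}" for t
  proof -
    have "0 \<le> u t" unfolding u_def by (rule cSup_upper[OF _ bdd]) (simp add: A_def)
    moreover have "u t \<le> 1" unfolding u_def by (rule cSup_least) (auto simp: A_def)
    ultimately show ?thesis by simp
  qed
  have lev: "level_set u \<alpha> = K \<alpha>" if \<alpha>: "\<alpha> \<in> {0<..1}" for \<alpha>
  proof
    show "K \<alpha> \<subseteq> level_set u \<alpha>"
      using \<alpha> cSup_upper[OF _ bdd, of \<alpha>] by (auto simp: level_set_pos u_def A_def)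
    show "level_set u \<alpha> \<subseteq> K \<alpha>"
    proof
      fix t assume "t \<in> level_set u \<alpha>"
      then have t: "\<alpha> \<le> Sup (A t)" using \<alpha> by (simp add: level_set_pos u_def)
      show "t \<in> K \<alpha>"
      proof (rule left[OF \<alpha>])
        fix \<beta> :: real assume \<beta>: "0 < \<beta>" "\<beta> < \<alpha>"
        then have "\<beta> < Sup (A t)" using t by simp
        then obtain \<gamma> where "\<gamma> \<in> A t" "\<beta> < \<gamma>"
          using less_cSupD[of "A t" \<beta>] by (auto simp: A_def)
        then show "t \<in> K \<beta>" using \<beta> anti[of \<gamma> \<beta>] by (auto simp: A_def)
      qed
    qed
  qed
  have "u \<in> fuzzy_vectors"
    using range levels \<open>bounded B\<close> by (intro fuzzy_vectorI[where B=B]) (auto simp: lev)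
  then show ?thesis using that lev by blast
qed

section \<open>Addition of fuzzy vectors\<close>

text \<open>Only the attainment of the supremum needs an argument. If it is at least \<open>\<alpha>\<close> at \<open>t\<close>, then for every
  \<open>\<beta> < \<alpha>\<close> the set of those \<open>r\<close> in level \<open>\<beta>\<close> of \<open>u\<close> for which \<open>t - r\<close> lies in level \<open>\<beta>\<close> of
  \<open>v\<close> is nonempty. These sets are compact and nested, so they share a point \<open>r\<close>, and by
  left-continuity \<open>t = r + (t - r)\<close> is a decomposition at level \<open>\<alpha>\<close> itself.\<close>

lemma level_set_add:
  fixes u v :: "real ^ 'n \<Rightarrow> real"
  assumes u: "u \<in> fuzzy_vectors" and v: "v \<in> fuzzy_vectors" and \<alpha>: "\<alpha> \<in> {0<..1}"
  shows "level_set (u \<oplus> v) \<alpha> = level_set u \<alpha> + level_set v \<alpha>"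
proof
  let ?M = "\<lambda>t. {min (u r) (v s) | r s. r + s = t}"
  have bdd: "bdd_above (?M t)" for t
    using fuzzy_vector_range[OF u] by (intro bdd_aboveI[of _ 1]) (auto simp: min_le_iff_disj)
  show "level_set u \<alpha> + level_set v \<alpha> \<subseteq> level_set (u \<oplus> v) \<alpha>"
  proof
    fix t assume "t \<in> level_set u \<alpha> + level_set v \<alpha>"
    then obtain r s where rs: "t = r + s" "\<alpha> \<le> u r" "\<alpha> \<le> v s"
      using \<alpha> by (auto simp: set_plus_def level_set_pos)
    have "\<alpha> \<le> min (u r) (v s)" using rs by simp
    also have "\<dots> \<le> Sup (?M t)" using rs by (intro cSup_upper[OF _ bdd]) auto
    finally show "t \<in> level_set (u \<oplus> v) \<alpha>" using \<alpha> by (simp add: level_set_pos fuzzy_add_def)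
  qed
  show "level_set (u \<oplus> v) \<alpha> \<subseteq> level_set u \<alpha> + level_set v \<alpha>"
  proof
    fix t assume "t \<in> level_set (u \<oplus> v) \<alpha>"
    then have t: "\<alpha> \<le> Sup (?M t)" using \<alpha> by (simp add: level_set_pos fuzzy_add_def)
    define S where "S = (\<lambda>\<beta>. level_set u \<beta> \<inter> (\<lambda>s. t - s) ` level_set v \<beta>)"
    have "\<Inter>(S ` {0<..<\<alpha>}) \<noteq> {}"
    proof (rule compact_chain)
      show "compact T" if "T \<in> S ` {0<..<\<alpha>}" for T
      proof -
        from that obtain \<beta> where "\<beta> \<in> {0<..<\<alpha>}" and "T = S \<beta>" by blast
        then have "\<beta> \<in> {0<..1}" "T = S \<beta>" using \<alpha> by auto
        then show ?thesis
          unfolding S_def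
          by (auto intro!: compact_Int compact_continuous_image continuous_intros
              level_set_compact u v)
      qed
      show "{} \<notin> S ` {0<..<\<alpha>}"
      proof
        assume "{} \<in> S ` {0<..<\<alpha>}"
        then obtain \<beta> where \<beta>: "0 < \<beta>" "\<beta> < \<alpha>" and e: "S \<beta> = {}" by auto
        have "?M t \<noteq> {}"
        proof -
          have "min (u t) (v 0) \<in> ?M t" by force
          then show ?thesis by blast
        qed
        moreover have "\<beta> < Sup (?M t)" using \<beta> t by simp
        ultimately have "\<exists>m\<in>?M t. \<beta> < m" by (rule less_cSupD)
        then obtain r s where "\<beta> < min (u r) (v s)" and t: "r + s = t" by blast
        then have "r \<in> level_set u \<beta>" "s \<in> level_set v \<beta>"
          using \<beta> by (auto simp: level_set_pos)
        moreover have "r = t - s" using t by (simp add: eq_diff_eq)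
        ultimately have "r \<in> S \<beta>" unfolding S_def by blast
        with e show False by simp
      qed
      show "T \<subseteq> T' \<or> T' \<subseteq> T" if TT: "T \<in> S ` {0<..<\<alpha>} \<and> T' \<in> S ` {0<..<\<alpha>}" for T T'
      proof -
        have mono: "S \<gamma> \<subseteq> S \<beta>" if "0 < \<beta>" "\<beta> \<le> \<gamma>" for \<beta> \<gamma>
          using level_set_antimono[OF that] unfolding S_def by (intro Int_mono image_mono)
        from TT obtain \<beta> \<gamma> where "0 < \<beta>" "0 < \<gamma>" and T: "T = S \<beta>" "T' = S \<gamma>" by auto
        then show ?thesis using mono[of \<beta> \<gamma>] mono[of \<gamma> \<beta>] by (cases "\<beta> \<le> \<gamma>") auto
      qed
    qed
    then obtain r where "r \<in> \<Inter>(S ` {0<..<\<alpha>})" by blast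
    then have r: "\<And>\<beta>. \<lbrakk>0 < \<beta>; \<beta> < \<alpha>\<rbrakk> \<Longrightarrow> r \<in> S \<beta>" by simp
    have "r \<in> level_set u \<alpha>"
      by (rule level_set_left_continuous) (use r \<alpha> in \<open>auto simp: S_def\<close>)
    moreover have "t - r \<in> level_set v \<alpha>"
    proof (rule level_set_left_continuous)
      fix \<beta> :: real assume "0 < \<beta>" "\<beta> < \<alpha>"
      from r[OF this] show "t - r \<in> level_set v \<beta>" by (auto simp: S_def)
    qed (use \<alpha> in simp)
    ultimately have "r + (t - r) \<in> level_set u \<alpha> + level_set v \<alpha>" by (rule set_plus_intro)
    then show "t \<in> level_set u \<alpha> + level_set v \<alpha>" by simp
  qed
qed

lemma fuzzy_add_closed:
  fixes u v :: "real ^ 'n \<Rightarrow> real"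
  assumes u: "u \<in> fuzzy_vectors" and v: "v \<in> fuzzy_vectors"
  shows "u \<oplus> v \<in> fuzzy_vectors"
proof -
  let ?B = "{t. u t > 0} + {t. v t > 0}"
  have "?B = (\<Union>x\<in>{t. u t > 0}. \<Union>y\<in>{t. v t > 0}. {x + y})"
    by (auto simp: set_plus_def)
  then have bB: "bounded ?B"
    using bounded_sums[OF bounded_support[OF u] bounded_support[OF v]] by simp
  have range: "(u \<oplus> v) t \<in> {0..1}" for t
  proof -
    let ?M = "{min (u r) (v s) | r s. r + s = t}"
    have mem: "min (u t) (v 0) \<in> ?M" by force
    have b1: "m \<le> 1" if "m \<in> ?M" for m
      using that fuzzy_vector_range[OF u] by (auto simp: min_le_iff_disj)
    have "0 \<le> min (u t) (v 0)"
      using fuzzy_vector_range[OF u, of t] fuzzy_vector_range[OF v, of 0] by simp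
    also have "\<dots> \<le> Sup ?M" using b1 by (intro cSup_upper mem bdd_aboveI[of _ 1])
    finally have "0 \<le> Sup ?M" .
    moreover have "Sup ?M \<le> 1" using mem b1 by (intro cSup_least) blast+
    ultimately show ?thesis by (simp add: fuzzy_add_def)
  qed
  show ?thesis
  proof (rule fuzzy_vectorI[OF range _ bB])
    fix \<alpha> :: real assume \<alpha>: "\<alpha> \<in> {0<..1}"
    then have "0 < \<alpha>" by simp
    from set_plus_mono[OF level_set_subset_support[OF this] level_set_subset_support[OF this]]
    have "level_set u \<alpha> + level_set v \<alpha> \<subseteq> ?B" .
    moreover have "level_set u \<alpha> + level_set v \<alpha> \<noteq> {}"
      using level_set_nonempty[OF u \<alpha>] level_set_nonempty[OF v \<alpha>] by (auto simp: set_plus_def)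
    ultimately show "level_set (u \<oplus> v) \<alpha> \<noteq> {} \<and> convex (level_set (u \<oplus> v) \<alpha>) \<and>
        closed (level_set (u \<oplus> v) \<alpha>) \<and> level_set (u \<oplus> v) \<alpha> \<subseteq> ?B"
      unfolding level_set_add[OF u v \<alpha>]
      using u v \<alpha>
      by (auto intro!: convex_set_plus level_set_convex compact_imp_closed compact_set_plus
          level_set_compact)
  qed
qed

lemma fuzzy_add_assoc:
  fixes u v w :: "real ^ 'n \<Rightarrow> real"
  assumes "u \<in> fuzzy_vectors" "v \<in> fuzzy_vectors" "w \<in> fuzzy_vectors"
  shows "(u \<oplus> v) \<oplus> w = u \<oplus> (v \<oplus> w)"
proof (rule fuzzy_vector_eqI)
  fix \<alpha> :: real assume \<alpha>: "\<alpha> \<in> {0<..1}"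
  note add = level_set_add[OF _ _ \<alpha>]
  show "level_set ((u \<oplus> v) \<oplus> w) \<alpha> = level_set (u \<oplus> (v \<oplus> w)) \<alpha>"
    unfolding add[OF fuzzy_add_closed[OF assms(1,2)] assms(3)] add[OF assms(1,2)]
      add[OF assms(1) fuzzy_add_closed[OF assms(2,3)]] add[OF assms(2,3)]
    by (rule add.assoc)
qed (intro fuzzy_add_closed assms)+

section \<open>Symmetric fuzzy vectors\<close>

text \<open>The orthogonal group acts transitively on spheres, so \<open>K\<close> contains the whole sphere through a
  point of maximal norm; by convexity it contains the ball that this sphere bounds. Even the
  one-dimensional case, where the sphere has two points, is covered.\<close>

lemma rotation_invariant_eq_cball:
  fixes K :: "(real ^ 'n) set"
  assumes K: "compact K" "convex K" "K \<noteq> {}"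
    and inv: "\<And>Q :: real ^ 'n ^ 'n. \<And>t. \<lbrakk>orthogonal_matrix Q; t \<in> K\<rbrakk> \<Longrightarrow> Q *v t \<in> K"
  obtains r where "0 \<le> r" "K = cball 0 r"
proof -
  obtain p where p: "p \<in> K" and max: "\<And>y. y \<in> K \<Longrightarrow> norm y \<le> norm p"
    using continuous_attains_sup[OF K(1,3), of norm] by (auto intro: continuous_intros)
  have sphere: "q \<in> K" if q: "norm q = norm p" for q
  proof -
    obtain f where f: "orthogonal_transformation f" "f p = q"
      using orthogonal_transformation_exists[OF q[symmetric]] by blast
    then have "orthogonal_matrix (matrix f)" "matrix f *v p = q"
      by (auto simp: orthogonal_transformation_matrix matrix_works)
    then show ?thesis using inv p by metis
  qed
  have "cball 0 (norm p) \<subseteq> K"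
  proof
    fix x :: "real ^ 'n" assume x: "x \<in> cball 0 (norm p)"
    show "x \<in> K"
    proof (cases "x = 0")
      case True
      have "(1/2) *\<^sub>R p + (1/2) *\<^sub>R (- p) \<in> K"
        using p sphere[of "- p"] by (intro convexD[OF K(2)]) auto
      then show ?thesis using True by simp
    next
      case False
      define q where "q = (norm p / norm x) *\<^sub>R x"
      \<comment> \<open>\<open>x\<close> lies on the diameter from \<open>- q\<close> to \<open>q\<close>, at the position \<open>a\<close>\<close>
      define a where "a = (norm x / norm p + 1) / 2"
      have pos: "0 < norm x" "0 < norm p" "norm x / norm p \<le> 1" using False x by (auto simp: divide_simps)
      have q: "norm q = norm p" using pos by (simp add: q_def)
      have "a *\<^sub>R q + (1 - a) *\<^sub>R (- q) \<in> K"
        using sphere[OF q] sphere[of "- q"] q pos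
        by (intro convexD[OF K(2)]) (auto simp: a_def)
      moreover have "a *\<^sub>R q + (1 - a) *\<^sub>R (- q) = (a - (1 - a)) *\<^sub>R q"
        unfolding scaleR_minus_right scaleR_diff_left[of a "1 - a"] by (rule add_uminus_conv_diff)
      moreover have "a - (1 - a) = norm x / norm p" by (simp add: a_def field_simps)
      moreover have "(norm x / norm p) *\<^sub>R q = x" using pos by (simp add: q_def)
      ultimately show ?thesis by simp
    qed
  qed
  with max have "K = cball 0 (norm p)" by auto
  then show ?thesis by (intro that[of "norm p"]) auto
qed

lemma symmetric_iff_level_balls:
  fixes w :: "real ^ 'n \<Rightarrow> real"
  assumes w: "w \<in> fuzzy_vectors"
  shows "w \<in> symmetric_fuzzy_vectors \<longleftrightarrow>
    (\<exists>\<rho>. \<forall>\<alpha>\<in>{0<..1}. 0 \<le> \<rho> \<alpha> \<and> level_set w \<alpha> = cball 0 (\<rho> \<alpha>))"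
proof
  assume sym: "w \<in> symmetric_fuzzy_vectors"
  have "\<exists>r. 0 \<le> r \<and> level_set w \<alpha> = cball 0 r" if \<alpha>: "\<alpha> \<in> {0<..1}" for \<alpha>
  proof -
    have "Q *v t \<in> level_set w \<alpha>" if "orthogonal_matrix Q" "t \<in> level_set w \<alpha>"
      for Q :: "real ^ 'n ^ 'n" and t
    proof -
      have "w t = w (Q *v t)" using sym that(1) unfolding symmetric_fuzzy_vectors_def by blast
      then show ?thesis using that(2) \<alpha> by (simp add: level_set_pos)
    qed
    then show ?thesis
      using rotation_invariant_eq_cball[OF level_set_compact level_set_convex level_set_nonempty] w \<alpha>
      by metis
  qed
  then show "\<exists>\<rho>. \<forall>\<alpha>\<in>{0<..1}. 0 \<le> \<rho> \<alpha> \<and> level_set w \<alpha> = cball 0 (\<rho> \<alpha>)" by metis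
next
  assume "\<exists>\<rho>. \<forall>\<alpha>\<in>{0<..1}. 0 \<le> \<rho> \<alpha> \<and> level_set w \<alpha> = cball 0 (\<rho> \<alpha>)"
  then obtain \<rho> where \<rho>: "\<And>\<alpha>. \<alpha> \<in> {0<..1} \<Longrightarrow> level_set w \<alpha> = cball 0 (\<rho> \<alpha>)" by blast
  have "w t = w (Q *v t)" if Q: "orthogonal_matrix Q" for t and Q :: "real ^ 'n ^ 'n"
  proof (rule unit_interval_eqI)
    fix \<alpha> :: real assume \<alpha>: "\<alpha> \<in> {0<..1}"
    have "norm (Q *v t) = norm t"
      using Q orthogonal_transformation_norm[of "(*v) Q" t]
      by (simp add: orthogonal_transformation_matrix)
    moreover have "\<alpha> \<le> w x \<longleftrightarrow> norm x \<le> \<rho> \<alpha>" for x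
      using \<rho>[OF \<alpha>] \<alpha> by (auto simp: level_set_pos set_eq_iff)
    ultimately show "\<alpha> \<le> w t \<longleftrightarrow> \<alpha> \<le> w (Q *v t)" by simp
  qed (use fuzzy_vector_range[OF w] in auto)
  then show "w \<in> symmetric_fuzzy_vectors" using w unfolding symmetric_fuzzy_vectors_def by blast
qed

lemma symmetric_imp_fuzzy: "w \<in> symmetric_fuzzy_vectors \<Longrightarrow> w \<in> fuzzy_vectors"
  unfolding symmetric_fuzzy_vectors_def by blast

lemma symmetric_fuzzy_add:
  fixes v w :: "real ^ 'n \<Rightarrow> real"
  assumes "v \<in> symmetric_fuzzy_vectors" "w \<in> symmetric_fuzzy_vectors"
  shows "v \<oplus> w \<in> symmetric_fuzzy_vectors"
proof -
  have vw: "v \<in> fuzzy_vectors" "w \<in> fuzzy_vectors"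
    using assms by (auto intro: symmetric_imp_fuzzy)
  obtain \<rho> \<sigma> where
    "\<forall>\<alpha>\<in>{0<..1}. 0 \<le> \<rho> \<alpha> \<and> level_set v \<alpha> = cball 0 (\<rho> \<alpha>)"
    "\<forall>\<alpha>\<in>{0<..1}. 0 \<le> \<sigma> \<alpha> \<and> level_set w \<alpha> = cball 0 (\<sigma> \<alpha>)"
    using assms symmetric_iff_level_balls vw by metis
  then have "\<forall>\<alpha>\<in>{0<..1}. 0 \<le> \<rho> \<alpha> + \<sigma> \<alpha> \<and> level_set (v \<oplus> w) \<alpha> = cball 0 (\<rho> \<alpha> + \<sigma> \<alpha>)"
    using vw by (simp add: level_set_add cball_plus_cball)
  then show ?thesis
    unfolding symmetric_iff_level_balls[OF fuzzy_add_closed[OF vw]]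
    by (intro exI[of _ "\<lambda>\<alpha>. \<rho> \<alpha> + \<sigma> \<alpha>"])
qed

lemma level_set_fuzzy_zero: "\<alpha> \<in> {0<..1} \<Longrightarrow> level_set fuzzy_zero \<alpha> = {0}"
  by (auto simp: level_set_pos fuzzy_zero_def split: if_splits)

lemma fuzzy_zero_symmetric: "fuzzy_zero \<in> symmetric_fuzzy_vectors"
proof -
  have z: "fuzzy_zero \<in> (fuzzy_vectors :: (real ^ 'n \<Rightarrow> real) set)"
  proof (rule fuzzy_vectorI)
    show "level_set fuzzy_zero \<alpha> \<noteq> {} \<and> convex (level_set fuzzy_zero \<alpha>) \<and>
        closed (level_set fuzzy_zero \<alpha>) \<and> level_set fuzzy_zero \<alpha> \<subseteq> {0 :: real ^ 'n}"
      if "\<alpha> \<in> {0<..1}" for \<alpha>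
      unfolding level_set_fuzzy_zero[OF that] by simp
  qed (simp_all add: fuzzy_zero_def)
  show ?thesis
    unfolding symmetric_iff_level_balls[OF z]
    by (intro exI[of _ "\<lambda>_. 0"]) (simp add: level_set_fuzzy_zero)
qed

lemma self_in_Upsilon:
  assumes "u \<in> fuzzy_vectors"
  shows "u \<in> Upsilon u"
proof -
  have "u = u \<oplus> fuzzy_zero"
  proof (rule fuzzy_vector_eqI)
    note z = symmetric_imp_fuzzy[OF fuzzy_zero_symmetric]
    show "u \<oplus> fuzzy_zero \<in> fuzzy_vectors" by (rule fuzzy_add_closed[OF assms z])
    show "level_set u \<alpha> = level_set (u \<oplus> fuzzy_zero) \<alpha>" if "\<alpha> \<in> {0<..1}" for \<alpha>
      unfolding level_set_add[OF assms z that] level_set_fuzzy_zero[OF that] by simp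
  qed (rule assms)
  with assms fuzzy_zero_symmetric show ?thesis unfolding Upsilon_def by blast
qed

section \<open>The core\<close>

lemma Upsilon_subset_fuzzy: "v \<in> Upsilon u \<Longrightarrow> v \<in> fuzzy_vectors"
  by (simp add: Upsilon_def)

text \<open>At each level the members of \<open>Upsilon u\<close> are summands of the level set of \<open>u\<close> complementary to balls,
  so their intersection is the summand complementary to the ball of supremal radius. It remains to
  see that the intersections and the balls are level sets of fuzzy vectors. For the intersections
  all conditions are inherited. For the balls the one delicate point is left-continuity of the
  radius \<open>R\<close>: if \<open>t\<close> lies in the balls of all levels \<open>\<beta> < \<alpha>\<close>, then \<open>C \<alpha> + cball 0 (norm t)\<close> lies in
  all lower levels of \<open>u\<close>, hence in level \<open>\<alpha>\<close>, which is \<open>C \<alpha> + cball 0 (R \<alpha>)\<close>; comparing radii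
  gives \<open>norm t \<le> R \<alpha>\<close>.\<close>

lemma core_decomposition:
  fixes u :: "real ^ 'n \<Rightarrow> real"
  assumes u: "u \<in> fuzzy_vectors"
  obtains c s where "c \<in> fuzzy_vectors" "s \<in> symmetric_fuzzy_vectors" "u = c \<oplus> s"
    "\<And>\<alpha>. \<alpha> \<in> {0<..1} \<Longrightarrow> level_set c \<alpha> = (\<Inter>v\<in>Upsilon u. level_set v \<alpha>)"
proof -
  have ne: "Upsilon u \<noteq> {}" using self_in_Upsilon[OF u] by blast
  have "\<forall>v\<in>Upsilon u. \<exists>\<rho>. \<forall>\<alpha>\<in>{0<..1}. 0 \<le> \<rho> \<alpha> \<and> level_set v \<alpha> + cball 0 (\<rho> \<alpha>) = level_set u \<alpha> \<and>
      (\<forall>\<beta>. 0 < \<beta> \<longrightarrow> \<beta> \<le> \<alpha> \<longrightarrow> \<rho> \<alpha> \<le> \<rho> \<beta>)"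
  proof
    fix v assume "v \<in> Upsilon u"
    then obtain w where v: "v \<in> fuzzy_vectors" and w: "w \<in> symmetric_fuzzy_vectors"
      and uvw: "u = v \<oplus> w" by (auto simp: Upsilon_def)
    have wf: "w \<in> fuzzy_vectors" using w by (rule symmetric_imp_fuzzy)
    obtain \<rho> where \<rho>: "\<And>\<alpha>. \<alpha> \<in> {0<..1} \<Longrightarrow> 0 \<le> \<rho> \<alpha> \<and> level_set w \<alpha> = cball 0 (\<rho> \<alpha>)"
      using w symmetric_iff_level_balls[OF wf] by blast
    have "\<rho> \<alpha> \<le> \<rho> \<beta>" if "\<alpha> \<in> {0<..1}" "0 < \<beta>" "\<beta> \<le> \<alpha>" for \<alpha> \<beta>
    proof -
      have "cball (0 :: real ^ 'n) (\<rho> \<alpha>) \<subseteq> cball 0 (\<rho> \<beta>)"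
        using level_set_antimono[OF that(2,3), of w] \<rho>[of \<alpha>] \<rho>[of \<beta>] that by auto
      then show ?thesis using \<rho>[OF that(1)] by (simp add: cball_subset_cball_iff)
    qed
    then show "\<exists>\<rho>. \<forall>\<alpha>\<in>{0<..1}. 0 \<le> \<rho> \<alpha> \<and> level_set v \<alpha> + cball 0 (\<rho> \<alpha>) = level_set u \<alpha> \<and>
      (\<forall>\<beta>. 0 < \<beta> \<longrightarrow> \<beta> \<le> \<alpha> \<longrightarrow> \<rho> \<alpha> \<le> \<rho> \<beta>)"
      using \<rho> level_set_add[OF v wf] uvw by (intro exI[of _ \<rho>]) auto
  qed
  then obtain r where r: "\<And>v \<alpha>. \<lbrakk>v \<in> Upsilon u; \<alpha> \<in> {0<..1}\<rbrakk> \<Longrightarrow>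
      0 \<le> r v \<alpha> \<and> level_set v \<alpha> + cball 0 (r v \<alpha>) = level_set u \<alpha> \<and>
      (\<forall>\<beta>. 0 < \<beta> \<longrightarrow> \<beta> \<le> \<alpha> \<longrightarrow> r v \<alpha> \<le> r v \<beta>)"
    by metis
  define C where "C = (\<lambda>\<alpha>. \<Inter>v\<in>Upsilon u. level_set v \<alpha>)"
  define R where "R = (\<lambda>\<alpha>. SUP v\<in>Upsilon u. r v \<alpha>)"
  have bdd: "bdd_above ((\<lambda>v. r v \<alpha>) ` Upsilon u)" and sum: "C \<alpha> + cball 0 (R \<alpha>) = level_set u \<alpha>"
    if \<alpha>: "\<alpha> \<in> {0<..1}" for \<alpha>
  proof -
    have v: "convex (level_set v \<alpha>)" "compact (level_set v \<alpha>)" "level_set v \<alpha> \<noteq> {}"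
      if "v \<in> Upsilon u" for v
      using Upsilon_subset_fuzzy[OF that] \<alpha> by (rule level_set_convex level_set_compact level_set_nonempty)+
    have rv: "0 \<le> r v \<alpha>" "level_set v \<alpha> + cball 0 (r v \<alpha>) = level_set u \<alpha>"
      if "v \<in> Upsilon u" for v
      using r[OF that \<alpha>] by blast+
    show "bdd_above ((\<lambda>v. r v \<alpha>) ` Upsilon u)"
      by (rule Inter_ball_summands(1)[OF ne v rv])
    show "C \<alpha> + cball 0 (R \<alpha>) = level_set u \<alpha>"
      unfolding C_def R_def by (rule Inter_ball_summands(2)[OF ne v rv])
  qed
  have R0: "0 \<le> R \<alpha>" if \<alpha>: "\<alpha> \<in> {0<..1}" for \<alpha>
  proof -
    have "0 \<le> r u \<alpha>" using r[OF self_in_Upsilon[OF u] \<alpha>] by blast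
    also have "\<dots> \<le> R \<alpha>"
      unfolding R_def by (rule cSUP_upper[OF self_in_Upsilon[OF u] bdd[OF \<alpha>]])
    finally show ?thesis .
  qed
  have Ranti: "R \<alpha> \<le> R \<beta>" if "\<alpha> \<in> {0<..1}" "0 < \<beta>" "\<beta> \<le> \<alpha>" for \<alpha> \<beta>
    unfolding R_def
  proof (rule cSUP_mono[OF ne bdd])
    show "\<beta> \<in> {0<..1}" using that by auto
    show "\<exists>w\<in>Upsilon u. r v \<alpha> \<le> r w \<beta>" if "v \<in> Upsilon u" for v
      using r[OF that \<open>\<alpha> \<in> {0<..1}\<close>] \<open>0 < \<beta>\<close> \<open>\<beta> \<le> \<alpha>\<close> that by blast
  qed
  have Cne: "C \<alpha> \<noteq> {}" if "\<alpha> \<in> {0<..1}" for \<alpha>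
    using sum[OF that] level_set_nonempty[OF u that] by (auto simp: set_plus_def)
  have Ccompact: "compact (C \<alpha>)" if "\<alpha> \<in> {0<..1}" for \<alpha>
    unfolding C_def using ne that Upsilon_subset_fuzzy[of _ u]
    by (intro compact_Inter) (auto intro!: level_set_compact)
  have Cconvex: "convex (C \<alpha>)" if "\<alpha> \<in> {0<..1}" for \<alpha>
    unfolding C_def using that Upsilon_subset_fuzzy[of _ u] by (intro convex_INT level_set_convex) auto
  have Cu: "C \<alpha> \<subseteq> level_set u \<alpha>" for \<alpha>
    unfolding C_def using self_in_Upsilon[OF u] by blast
  have Canti: "C \<alpha> \<subseteq> C \<beta>" if "0 < \<beta>" "\<beta> \<le> \<alpha>" for \<alpha> \<beta>
    unfolding C_def using level_set_antimono[OF that] by blast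
  obtain c where c: "c \<in> fuzzy_vectors" and clev: "\<And>\<alpha>. \<alpha> \<in> {0<..1} \<Longrightarrow> level_set c \<alpha> = C \<alpha>"
  proof (rule fuzzy_vector_with_level_sets[of C "{t. u t > 0}"])
    show "C \<alpha> \<noteq> {} \<and> convex (C \<alpha>) \<and> closed (C \<alpha>) \<and> C \<alpha> \<subseteq> {t. u t > 0}"
      if \<alpha>: "\<alpha> \<in> {0<..1}" for \<alpha>
      using Cne Ccompact Cconvex \<alpha> order.trans[OF Cu level_set_subset_support, of \<alpha>]
      by (auto intro: compact_imp_closed)
    show "t \<in> C \<alpha>" if "\<alpha> \<in> {0<..1}" "\<And>\<beta>. \<lbrakk>0 < \<beta>; \<beta> < \<alpha>\<rbrakk> \<Longrightarrow> t \<in> C \<beta>" for \<alpha> t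
      using that level_set_left_continuous[of \<alpha> t] by (auto simp: C_def)
  qed (use bounded_support[OF u] Canti in auto)
  obtain s :: "real ^ 'n \<Rightarrow> real" where s: "s \<in> fuzzy_vectors"
    and slev: "\<And>\<alpha>. \<alpha> \<in> {0<..1} \<Longrightarrow> level_set s \<alpha> = cball 0 (R \<alpha>)"
  proof -
    obtain M where M: "\<And>C r. \<lbrakk>C \<noteq> {}; 0 \<le> r; C + cball 0 r \<subseteq> {t. u t > 0}\<rbrakk> \<Longrightarrow> r \<le> M"
      using summand_radius_bound[OF bounded_support[OF u]] by metis
    have RM: "R \<alpha> \<le> M" if \<alpha>: "\<alpha> \<in> {0<..1}" for \<alpha>
      using M[OF Cne[OF \<alpha>] R0[OF \<alpha>]] sum[OF \<alpha>] level_set_subset_support[of \<alpha> u] \<alpha> by simp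
    let ?B = "\<lambda>\<alpha>. cball (0 :: real ^ 'n) (R \<alpha>)"
    show thesis
    proof (rule fuzzy_vector_with_level_sets[of ?B "cball 0 M"])
      show "?B \<alpha> \<noteq> {} \<and> convex (?B \<alpha>) \<and> closed (?B \<alpha>) \<and> ?B \<alpha> \<subseteq> cball 0 M" if "\<alpha> \<in> {0<..1}" for \<alpha>
        using R0[OF that] RM[OF that] by (auto simp: cball_subset_cball_iff)
      show "t \<in> cball 0 (R \<alpha>)"
        if \<alpha>: "\<alpha> \<in> {0<..1}" and t: "\<And>\<beta>. \<lbrakk>0 < \<beta>; \<beta> < \<alpha>\<rbrakk> \<Longrightarrow> t \<in> cball 0 (R \<beta>)"
        for \<alpha> and t :: "real ^ 'n"
      proof -
        have "C \<alpha> + cball 0 (norm t) \<subseteq> C \<alpha> + cball 0 (R \<alpha>)"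
        proof
          fix x assume x: "x \<in> C \<alpha> + cball 0 (norm t)"
          have "x \<in> level_set u \<alpha>"
          proof (rule level_set_left_continuous)
            fix \<beta> :: real assume \<beta>: "0 < \<beta>" "\<beta> < \<alpha>"
            have "C \<alpha> + cball 0 (norm t) \<subseteq> C \<beta> + cball 0 (R \<beta>)"
              using Canti[of \<beta> \<alpha>] t[of \<beta>] \<beta> by (intro set_plus_mono) (auto simp: cball_subset_cball_iff)
            also have "\<dots> = level_set u \<beta>" using sum[of \<beta>] \<alpha> \<beta> by simp
            finally show "x \<in> level_set u \<beta>" using x by blast
          qed (use \<alpha> in simp)
          then show "x \<in> C \<alpha> + cball 0 (R \<alpha>)" using sum[OF \<alpha>] by simp
        qed
        then have "norm t \<le> R \<alpha>"
          by (rule radius_le_if_sum_subset[OF Ccompact[OF \<alpha>] Cne[OF \<alpha>] norm_ge_zero])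
        then show ?thesis by simp
      qed
      show "?B \<alpha> \<subseteq> ?B \<beta>" if "\<alpha> \<in> {0<..1}" "0 < \<beta>" "\<beta> \<le> \<alpha>" for \<alpha> \<beta>
        using Ranti[OF that] by (simp add: cball_subset_cball_iff)
    qed (fact bounded_cball that)+
  qed
  have "s \<in> symmetric_fuzzy_vectors"
    unfolding symmetric_iff_level_balls[OF s] using R0 slev by (intro exI[of _ R]) auto
  moreover have "u = c \<oplus> s"
  proof (rule fuzzy_vector_eqI[OF u fuzzy_add_closed[OF c s]])
    fix \<alpha> :: real assume \<alpha>: "\<alpha> \<in> {0<..1}"
    show "level_set u \<alpha> = level_set (c \<oplus> s) \<alpha>"
      unfolding level_set_add[OF c s \<alpha>] clev[OF \<alpha>] slev[OF \<alpha>] sum[OF \<alpha>] ..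
  qed
  ultimately show ?thesis
    using that[of c s] c clev by (simp add: C_def)
qed

text \<open>The condition at level 0 in the definition of \<open>core_part\<close> holds for every fuzzy vector, so the
  positive levels identify the described vector.\<close>

lemma core_part_eqI:
  assumes c: "c \<in> fuzzy_vectors"
    and lev: "\<And>\<alpha>. \<alpha> \<in> {0<..1} \<Longrightarrow> level_set c \<alpha> = (\<Inter>v\<in>Upsilon u. level_set v \<alpha>)"
  shows "core_part u = c"
  unfolding core_part_def
proof (rule the_equality)
  show "c \<in> fuzzy_vectors \<and>
     (\<forall>\<alpha>\<in>{0<..1}. level_set c \<alpha> = (\<Inter>v\<in>Upsilon u. level_set v \<alpha>)) \<and>
     level_set c 0 = closure (\<Union>\<beta>\<in>{0<..1}. level_set c \<beta>)"
    using c lev level_set_zero[OF c] by blast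
  show "d = c" if "d \<in> fuzzy_vectors \<and>
     (\<forall>\<alpha>\<in>{0<..1}. level_set d \<alpha> = (\<Inter>v\<in>Upsilon u. level_set v \<alpha>)) \<and>
     level_set d 0 = closure (\<Union>\<beta>\<in>{0<..1}. level_set d \<beta>)" for d
    using that c lev by (intro fuzzy_vector_eqI) auto
qed

text \<open>Splitting a symmetric \<open>w\<close> off \<open>c\<close> leaves a \<open>v\<close> that still belongs to \<open>Upsilon u\<close>, since \<open>w\<close> can be
  absorbed into \<open>s\<close>. Then \<open>c\<close> is both \<open>v\<close> enlarged by the balls of \<open>w\<close> and, by hypothesis, below
  \<open>v\<close>, which forces the radii of these balls to vanish.\<close>

lemma skew_if_below_Upsilon:
  fixes u c s :: "real ^ 'n \<Rightarrow> real"
  assumes c: "c \<in> fuzzy_vectors" and s: "s \<in> symmetric_fuzzy_vectors" and u: "u = c \<oplus> s"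
    and below: "\<And>v \<alpha>. \<lbrakk>v \<in> Upsilon u; \<alpha> \<in> {0<..1}\<rbrakk> \<Longrightarrow> level_set c \<alpha> \<subseteq> level_set v \<alpha>"
  shows "skew c"
proof -
  have "w = fuzzy_zero" if v: "v \<in> fuzzy_vectors" and w: "w \<in> symmetric_fuzzy_vectors"
    and cvw: "c = v \<oplus> w" for v w
  proof -
    have wf: "w \<in> fuzzy_vectors" and sf: "s \<in> fuzzy_vectors"
      using w s by (auto intro: symmetric_imp_fuzzy)
    have "u = v \<oplus> (w \<oplus> s)" using u cvw fuzzy_add_assoc[OF v wf sf] by simp
    then have vU: "v \<in> Upsilon u"
      using v symmetric_fuzzy_add[OF w s] by (auto simp: Upsilon_def)
    obtain \<rho> where \<rho>: "\<And>\<alpha>. \<alpha> \<in> {0<..1} \<Longrightarrow> 0 \<le> \<rho> \<alpha> \<and> level_set w \<alpha> = cball 0 (\<rho> \<alpha>)"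
      using w symmetric_iff_level_balls[OF wf] by blast
    show ?thesis
    proof (rule fuzzy_vector_eqI[OF wf symmetric_imp_fuzzy[OF fuzzy_zero_symmetric]])
      fix \<alpha> :: real assume \<alpha>: "\<alpha> \<in> {0<..1}"
      have "level_set v \<alpha> + cball 0 (\<rho> \<alpha>) \<subseteq> level_set v \<alpha> + cball 0 0"
        using below[OF vU \<alpha>] level_set_add[OF v wf \<alpha>] \<rho>[OF \<alpha>] cvw by simp
      then have "\<rho> \<alpha> \<le> 0"
        using radius_le_if_sum_subset[OF level_set_compact[OF v \<alpha>] level_set_nonempty[OF v \<alpha>]] \<rho>[OF \<alpha>]
        by blast
      then show "level_set w \<alpha> = level_set fuzzy_zero \<alpha>"
        using \<rho>[OF \<alpha>] by (simp add: level_set_fuzzy_zero[OF \<alpha>])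
    qed
  qed
  then show ?thesis using c by (auto simp: skew_def)
qed

theorem theorem3p4p5:
  fixes u :: "real ^ 'n \<Rightarrow> real"
  assumes "u \<in> fuzzy_vectors"
  shows "skew (core_part u) \<and>
         (\<exists>s\<in>symmetric_fuzzy_vectors. u = core_part u \<oplus> s) \<and>
         is_mares_core (core_part u) u"
proof -
  obtain c s where c: "c \<in> fuzzy_vectors" and s: "s \<in> symmetric_fuzzy_vectors" and u: "u = c \<oplus> s"
    and lev: "\<And>\<alpha>. \<alpha> \<in> {0<..1} \<Longrightarrow> level_set c \<alpha> = (\<Inter>v\<in>Upsilon u. level_set v \<alpha>)"
    using core_decomposition[OF assms] by blast
  have "core_part u = c" by (rule core_part_eqI[OF c lev])
  moreover have "skew c"
    using lev by (intro skew_if_below_Upsilon[OF c s u]) blast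
  ultimately show ?thesis using c s u by (auto simp: is_mares_core_def)
qed

end
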